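(* Consider an $N$-armed bandit game with arm set $\mathcal A$, $|\mathcal A|=N$, played for $T$ time steps under the dynamic doubling batching scheme (as used by the algorithm BLTS). Then the total number of batches is at most $O(N\log T)$.
   Context: Dynamic doubling batching scheme: for each arm $a\in\mathcal A$ maintain a counter $k_a$ (number of times $a$ has been played so far) and an integer $l_a$, both initialized to $0$. At each time $t=1,\dots,T$ an arm $a_t\in\mathcal A$ is played (chosen by the algorithm, here Batched Langevin Thompson Sampling (BLTS), using only rewards observed in previous batches) and $k_{a_t}$ is increased by $1$. If then $k_{a_t}=2^{l_{a_t}}$, the integer $l_{a_t}$ is increased by $1$, the current batch is terminated (all rewards obtained in the batch are observed), and a new batch starts at the next time step. The batching rule depends only on the sequence of arms played. The $O(\cdot)$ hides an absolute constant. *)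

theory Defs
  imports Complex_Main
begin

text \<open>
  The dynamic doubling batching scheme, driven by a sequence of played arms.  The field
  \<open>current\<close> is the index of the current batch, i.e. the number of batches terminated so far.
\<close>

record 'a dd_state =
  plays :: "'a \<Rightarrow> nat"
  level :: "'a \<Rightarrow> nat"
  current :: nat

definition dd_init :: "'a dd_state" where
  "dd_init = \<lparr>plays = (\<lambda>_. 0), level = (\<lambda>_. 0), current = 0\<rparr>"

definition dd_play :: "'a \<Rightarrow> 'a dd_state \<Rightarrow> 'a dd_state" where
  "dd_play a s = s\<lparr>plays := (plays s)(a := plays s a + 1)\<rparr>"

definition dd_check :: "'a \<Rightarrow> 'a dd_state \<Rightarrow> 'a dd_state" where
  "dd_check a s =
     (if plays s a = 2 ^ level s a
      then s\<lparr>level := (level s)(a := level s a + 1), current := current s + 1\<rparr>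
      else s)"

text \<open>
  State after time step \<open>t\<close>, where \<open>arm t\<close> is the arm played at time \<open>t\<close> and time starts at 1
  (so \<open>arm 0\<close> is irrelevant).
\<close>

primrec dd_run :: "(nat \<Rightarrow> 'a) \<Rightarrow> nat \<Rightarrow> 'a dd_state" where
  "dd_run arm 0 = dd_init"
| "dd_run arm (Suc t) = dd_check (arm (Suc t)) (dd_play (arm (Suc t)) (dd_run arm t))"

text \<open>
  A time step belongs to the batch that is current just before it: the step whose play triggers
  a termination is the last one of its batch.
\<close>

definition batch_of :: "(nat \<Rightarrow> 'a) \<Rightarrow> nat \<Rightarrow> nat" where
  "batch_of arm t = current (dd_run arm (t - 1))"

text \<open>
  The final batch counts even if it is still open at time \<open>T\<close>; a batch that would only start at
  time \<open>T + 1\<close> does not.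
\<close>

definition num_batches :: "(nat \<Rightarrow> 'a) \<Rightarrow> nat \<Rightarrow> nat" where
  "num_batches arm T = card (batch_of arm ` {1..T})"

end

theory Submission
  imports Defs
begin

text \<open>
  The number of terminated batches is the sum over the arms of their levels, and an arm at level
  \<open>l > 0\<close> has been played at least \<open>2 ^ (l - 1)\<close> times, so each level is logarithmic in \<open>T\<close>.
\<close>

lemma mono_current_dd_run: "mono (\<lambda>t. current (dd_run arm t))"
  by (rule mono_iff_le_Suc[THEN iffD2]) (simp add: dd_check_def dd_play_def)

lemma plays_dd_run_le: "plays (dd_run arm t) a \<le> t"
proof (induction t)
  case (Suc t)
  then show ?case by (auto simp: dd_check_def dd_play_def)
qed (simp add: dd_init_def)

text \<open>A termination raises \<open>current\<close> and the level of the played arm together,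
  and that arm lies in \<open>A\<close>; \<open>sum.remove\<close> isolates its summand.\<close>

lemma current_dd_run_eq_sum_level:
  assumes "finite A" and "\<forall>s\<in>{1..t}. arm s \<in> A"
  shows "current (dd_run arm t) = (\<Sum>a\<in>A. level (dd_run arm t) a)"
  using assms(2)
proof (induction t)
  case (Suc t)
  then have IH: "current (dd_run arm t) = (\<Sum>a\<in>A. level (dd_run arm t) a)" by auto
  have "arm (Suc t) \<in> A" using Suc.prems by auto
  then show ?case using assms(1)
    by (simp add: dd_check_def dd_play_def IH sum.remove[of A "arm (Suc t)"])
qed (simp add: dd_init_def)

text \<open>The summand 1 covers arms that have not been played, whose level is 0.\<close>

lemma two_power_level_le: "2 ^ level (dd_run arm t) a \<le> 2 * plays (dd_run arm t) a + 1"
proof (induction t)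
  case (Suc t)
  \<comment> \<open>A level rises only when \<open>plays\<close> equals the old power of two, so the
    doubled power is exactly twice \<open>plays\<close>.\<close>
  then show ?case by (auto simp: dd_check_def dd_play_def)
qed (simp add: dd_init_def)

lemma level_dd_run_le:
  assumes "T \<ge> 2" and "t \<le> T"
  shows "real (level (dd_run arm t) a) \<le> 3 * log 2 (real T)"
proof -
  have "2 ^ level (dd_run arm t) a \<le> 2 * T + 1"
    using two_power_level_le[of arm t a] plays_dd_run_le[of arm t a] assms(2) by linarith
  \<comment> \<open>The additive 1 is absorbed into a pure power of \<open>T\<close>, using
    \<open>4 \<le> T ^ 2\<close>; the exponent 3 becomes the factor of the logarithm.\<close>
  also have "\<dots> \<le> 4 * T" using assms(1) by simp
  also have "\<dots> \<le> T ^ 2 * T" using power_mono[OF assms(1), of 2] by (intro mult_right_mono) auto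
  finally have "2 ^ level (dd_run arm t) a \<le> T ^ 3" by (simp add: eval_nat_numeral)
  then have "(2::real) ^ level (dd_run arm t) a \<le> real T ^ 3"
    by (metis of_nat_le_iff of_nat_numeral of_nat_power)
  then have "real (level (dd_run arm t) a) \<le> log 2 (real T ^ 3)"
    by (intro le_log_of_power) simp_all
  then show ?thesis using assms(1) by (simp add: log_nat_power)
qed

text \<open>Batch indices start at 0 and, by monotonicity, never exceed the final value of
  \<open>current\<close>; the extra 1 allows for a batch still open at time
  \<open>T\<close>.\<close>

lemma num_batches_le: "num_batches arm T \<le> current (dd_run arm T) + 1"
proof -
  have "batch_of arm ` {1..T} \<subseteq> {..current (dd_run arm T)}"
    by (auto simp: batch_of_def intro!: monoD[OF mono_current_dd_run])
  from card_mono[OF finite_atMost this] show ?thesis by (simp add: num_batches_def)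
qed

theorem theorem2:
  "\<exists>C::real. C > 0 \<and>
     (\<forall>(A::'a set) (N::nat) (T::nat) (arm::nat \<Rightarrow> 'a).
        finite A \<longrightarrow> card A = N \<longrightarrow> N \<ge> 1 \<longrightarrow> T \<ge> 2 \<longrightarrow> (\<forall>t\<in>{1..T}. arm t \<in> A) \<longrightarrow>
        real (num_batches arm T) \<le> C * (real N * ln (real T)))"
\<comment> \<open>In the witness, 3 comes from the level bound, 1 from the possibly open batch, and
  \<open>ln 2\<close> from the change of base.\<close>
proof (intro exI[of _ "4 / ln 2"] conjI allI impI)
  fix A :: "'a set" and N T :: nat and arm :: "nat \<Rightarrow> 'a"
  assume A: "finite A" "card A = N" "N \<ge> 1" and T: "T \<ge> 2" and arm: "\<forall>t\<in>{1..T}. arm t \<in> A"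
  have "real (current (dd_run arm T)) = (\<Sum>a\<in>A. real (level (dd_run arm T) a))"
    using current_dd_run_eq_sum_level[OF A(1) arm] by simp
  also have "\<dots> \<le> real N * (3 * log 2 (real T))"
    unfolding A(2)[symmetric] by (intro sum_bounded_above level_dd_run_le[OF T]) simp
  finally have "real (current (dd_run arm T)) \<le> real N * (3 * log 2 (real T))" .
  \<comment> \<open>This lets the open batch be charged to the main term.\<close>
  moreover have "1 * 1 \<le> real N * log 2 (real T)"
    using A(3) T by (intro mult_mono) auto
  ultimately have "real (num_batches arm T) \<le> 4 * (real N * log 2 (real T))"
    using num_batches_le[of arm T] by linarith
  then show "real (num_batches arm T) \<le> 4 / ln 2 * (real N * ln (real T))"
    by (simp add: log_def)
qed simp

end
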